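(* Let $\lambda_0=[3;3,3,2,1,\overline{1,2}]+[0;2,1,\overline{1,2}]=\frac{62976-1498\sqrt{3}}{16357}$. Then $\lambda_0\in\mathbb{L}$, and no irrational $\alpha$ with $\mu(\alpha)=\lambda_0$ is attainable.
   Context: For real irrational $\alpha$, the Lagrange constant is defined by $\mu(\alpha)^{-1}=\liminf_{q\to\infty,\ q\in\mathbb{N},\ p\in\mathbb{Z}}|q(q\alpha-p)|$. The Lagrange spectrum $\mathbb{L}$ is the set of all finite values taken by $\mu(\alpha)$ as $\alpha$ ranges over the reals. An irrational $\alpha$ is called attainable if the inequality $|\alpha-p/q|\le \frac{1}{\mu(\alpha)q^2}$ has infinitely many solutions in integers $p$ and positive integers $q$. The overline denotes an infinitely repeated period in a continued fraction. *)

theory Defs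
  imports Complex_Main "HOL-Library.Extended_Real" "HOL-Library.Stream"
begin

text \<open>
  The lower limit is taken over pairs \<open>(q, p)\<close> along the filter ``\<open>q\<close> tends to infinity,
  \<open>p\<close> unrestricted''. It lives in the extended reals, so that the constant is \<open>\<infinity>\<close>
  exactly when the lower limit is \<open>0\<close>.
\<close>

definition lagrange_constant :: "real \<Rightarrow> ereal" where
  "lagrange_constant \<alpha> =
     inverse (Liminf (filtercomap fst sequentially)
       (\<lambda>(q::nat, p::int). ereal \<bar>real q * (real q * \<alpha> - of_int p)\<bar>))"

definition lagrange_spectrum :: "real set" where
  "lagrange_spectrum = {x. \<exists>\<alpha>. \<alpha> \<notin> \<rat> \<and> lagrange_constant \<alpha> = ereal x}"

definition attainable :: "real \<Rightarrow> bool" where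
  "attainable \<alpha> \<longleftrightarrow> \<alpha> \<notin> \<rat> \<and>
     infinite {(p::int, q::nat). q > 0 \<and>
       ereal \<bar>\<alpha> - of_int p / real q\<bar> \<le> 1 / (lagrange_constant \<alpha> * ereal ((real q)\<^sup>2))}"

primrec cfrac_convergent :: "nat \<Rightarrow> int stream \<Rightarrow> real" where
  "cfrac_convergent 0 s = of_int (shd s)"
| "cfrac_convergent (Suc n) s = of_int (shd s) + 1 / cfrac_convergent n (stl s)"

definition cfrac :: "int stream \<Rightarrow> real" where
  "cfrac s = lim (\<lambda>n. cfrac_convergent n s)"

end

theory Submission imports Defs
begin

text \<open>
  Perron's formula expresses the approximation quality of the convergents of \<open>\<alpha>\<close> as
  \<open>1 / \<lambda>\<^sub>n\<close> with \<open>\<lambda>\<^sub>n = [a\<^sub>n; a\<^sub>n\<^sub>+\<^sub>1, \<dots>] + [0; a\<^sub>n\<^sub>-\<^sub>1, \<dots>, a\<^sub>1]\<close>, and by Legendre's criterion only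
  convergents matter. If eventually \<open>\<lambda>\<^sub>n\<close> is below a bound slightly larger than \<open>\<lambda>\<^sub>0\<close>, then only the
  digits \<open>1, 2, 3\<close> occur from some point on and the words \<open>13\<close>, \<open>31\<close>, \<open>232\<close>, \<open>223\<close>, \<open>323\<close>, \<open>322\<close>
  do not. This already forces \<open>\<lambda>\<^sub>n < \<lambda>\<^sub>0\<close> eventually: a large \<open>\<lambda>\<^sub>n\<close> needs a digit \<open>3\<close>
  with neighbours \<open>2\<close> and \<open>3\<close>, and the two tails are then at most those in \<open>\<lambda>\<^sub>0\<close>, where the
  backward tail is strictly smaller because it is finite and meets an earlier \<open>3\<close>. Hence \<open>\<lambda>\<^sub>0\<close> is never
  attained. It is a Lagrange constant because it is approached along blocks \<open>1 2 3 3 3 2 1\<close>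
  that are separated by longer and longer alternating strings of \<open>1\<close> and \<open>2\<close>.
\<close>

section \<open>Convergence of continued fractions\<close>

lemma sset_stl_subset: "sset s \<subseteq> A \<Longrightarrow> sset (stl s) \<subseteq> A"
  using stl_sset[of _ s] by blast

lemma cfrac_convergent_ge_1:
  assumes "sset s \<subseteq> {1..}"
  shows "1 \<le> cfrac_convergent n s"
  using assms
proof (induction n arbitrary: s)
  case 0
  then show ?case using shd_sset[of s] by auto
next
  case (Suc n)
  have "sset (stl s) \<subseteq> {1..}"
    using Suc.prems by (rule sset_stl_subset)
  from Suc.IH[OF this] have "0 \<le> 1 / cfrac_convergent n (stl s)"
    by simp
  moreover have "1 \<le> real_of_int (shd s)"
    using Suc.prems shd_sset[of s] by auto
  ultimately show ?case unfolding cfrac_convergent.simps by linarith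
qed

text \<open>Levels are taken in pairs because a single inversion need not contract near 1. The map
  from \<open>X\<close> to \<open>1 / (b + 1 / X) = X / (b * X + 1)\<close> divides distances by
  \<open>(b * X + 1) * (b * Y + 1)\<close>, which is at least 4.\<close>

lemma cfrac_convergent_contraction:
  assumes "sset s \<subseteq> {1..}"
  shows "\<bar>cfrac_convergent (2 * k + i) s - cfrac_convergent (2 * k + j) s\<bar> \<le> (1 / 4) ^ k"
  using assms
proof (induction k arbitrary: s)
  case 0
  have bounds: "real_of_int (shd s) \<le> cfrac_convergent m s \<and> cfrac_convergent m s \<le> shd s + 1" for m
  proof (cases m)
    case (Suc m')
    have "sset (stl s) \<subseteq> {1..}"
      using 0 by (rule sset_stl_subset)
    from cfrac_convergent_ge_1[OF this, of m'] show ?thesis by (simp add: Suc field_simps)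
  qed simp
  show ?case using bounds[of i] bounds[of j] by (auto simp: abs_le_iff)
next
  case (Suc k)
  define X Y where "X = cfrac_convergent (2 * k + i) (stl (stl s))"
    and "Y = cfrac_convergent (2 * k + j) (stl (stl s))"
  define b where "b = real_of_int (shd (stl s))"
  have pos1: "sset (stl s) \<subseteq> {1..}" and pos: "sset (stl (stl s)) \<subseteq> {1..}"
    using Suc.prems by (auto dest!: stl_sset)
  then have b: "1 \<le> b"
    using shd_sset[of "stl s"] by (auto simp: b_def)
  have X: "1 \<le> X" and Y: "1 \<le> Y"
    using cfrac_convergent_ge_1[OF pos] by (auto simp: X_def Y_def)
  have XY: "\<bar>X - Y\<bar> \<le> (1 / 4) ^ k"
    using Suc.IH[OF pos] by (simp add: X_def Y_def)
  have bX: "2 \<le> b * X + 1" and bY: "2 \<le> b * Y + 1"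
    using mult_mono[OF b X] mult_mono[OF b Y] b by auto
  have "1 / (b + 1 / X) - 1 / (b + 1 / Y) = X / (b * X + 1) - Y / (b * Y + 1)"
    using X Y by (simp add: add_divide_eq_iff)
  also have "\<dots> = (X - Y) / ((b * X + 1) * (b * Y + 1))"
    using bX bY by (subst diff_frac_eq) (auto simp: algebra_simps)
  finally have "\<bar>1 / (b + 1 / X) - 1 / (b + 1 / Y)\<bar> = \<bar>X - Y\<bar> / ((b * X + 1) * (b * Y + 1))"
    using bX bY by (simp add: abs_mult)
  also have "\<dots> \<le> (1 / 4) ^ k / (2 * 2)"
    using XY by (intro frac_le mult_mono) (use bX bY in auto)
  finally show ?case
    by (simp add: X_def Y_def b_def)
qed

lemma cfrac_convergent_tendsto:
  assumes "sset s \<subseteq> {1..}"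
  shows "(\<lambda>n. cfrac_convergent n s) \<longlonglongrightarrow> cfrac s"
proof -
  have "Cauchy (\<lambda>n. cfrac_convergent n s)"
    unfolding Cauchy_def dist_real_def
  proof (intro allI impI)
    fix e :: real assume "0 < e"
    then obtain k where k: "(1 / 4 :: real) ^ k < e"
      using real_arch_pow_inv[of e "1 / 4"] by auto
    have "\<bar>cfrac_convergent m s - cfrac_convergent n s\<bar> < e" if "2 * k \<le> m" "2 * k \<le> n" for m n
      using cfrac_convergent_contraction[OF assms, of k "m - 2 * k" "n - 2 * k"] that k by simp
    then show "\<exists>M. \<forall>m\<ge>M. \<forall>n\<ge>M. \<bar>cfrac_convergent m s - cfrac_convergent n s\<bar> < e"
      by blast
  qed
  then show ?thesis
    by (simp add: cfrac_def Cauchy_convergent_iff convergent_LIMSEQ_iff)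
qed

lemma cfrac_ge_1:
  assumes "sset s \<subseteq> {1..}"
  shows "1 \<le> cfrac s"
  using LIMSEQ_le_const[OF cfrac_convergent_tendsto[OF assms]] cfrac_convergent_ge_1[OF assms] by blast

lemma cfrac_unfold:
  assumes "sset (stl s) \<subseteq> {1..}"
  shows "cfrac s = shd s + 1 / cfrac (stl s)"
proof -
  have "(\<lambda>n. cfrac_convergent (Suc n) s) \<longlonglongrightarrow> shd s + 1 / cfrac (stl s)"
    using cfrac_convergent_tendsto[OF assms] cfrac_ge_1[OF assms]
    by (auto intro!: tendsto_intros)
  then have "(\<lambda>n. cfrac_convergent n s) \<longlonglongrightarrow> shd s + 1 / cfrac (stl s)"
    by (rule LIMSEQ_imp_Suc)
  then show ?thesis
    unfolding cfrac_def by (rule limI)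
qed

lemma cfrac_SCons: "sset s \<subseteq> {1..} \<Longrightarrow> cfrac (k ## s) = k + 1 / cfrac s"
  using cfrac_unfold[of "k ## s"] by simp

lemma sset_cycle_1_2: "sset (cycle [1, 2 :: int]) \<subseteq> {1..}"
  by (simp add: sset_cycle)

text \<open>Periodicity gives the quadratic equation \<open>(2 * c - 1)^2 = 3\<close>. The root is
  written as a reciprocal because it is \<open>sqrt 3 - 1\<close> that enters the tails.\<close>

lemma cfrac_cycle_1_2: "cfrac (cycle [1, 2]) = 1 / (sqrt 3 - 1)"
proof -
  let ?c = "cfrac (cycle [1, 2])"
  have cyc: "cycle [1, 2 :: int] = [1, 2] @- cycle [1, 2]"
    by (rule cycle_decomp) simp
  have c1: "1 \<le> ?c"
    by (rule cfrac_ge_1) (rule sset_cycle_1_2)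
  have "?c = cfrac ([1, 2] @- cycle [1, 2])"
    by (rule arg_cong[OF cyc])
  also have "\<dots> = 1 + 1 / (2 + 1 / ?c)"
    using sset_cycle_1_2 by (simp add: cfrac_SCons)
  also have "\<dots> = (3 * ?c + 1) / (2 * ?c + 1)"
    using c1 by (simp add: field_simps)
  finally have "?c * (2 * ?c + 1) = 3 * ?c + 1"
    using c1 by (subst (asm) eq_divide_eq) auto
  then have "(2 * ?c - 1)\<^sup>2 = 3"
    by (simp add: power2_eq_square algebra_simps)
  then have "2 * ?c - 1 = sqrt 3"
    using c1 by (intro real_sqrt_unique[symmetric]) auto
  then have "?c = (1 + sqrt 3) / 2"
    by simp
  also have "\<dots> = 1 / (sqrt 3 - 1)"
    by (simp add: divide_eq_eq eq_divide_eq algebra_simps)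
  finally show ?thesis .
qed

section \<open>Approximation by convergents\<close>

text \<open>The \<open>x n\<close> are the complete quotients. Their recursion covers both the
  expansion of an arbitrary irrational and a number built from prescribed digits; \<open>a 0\<close>
  may be any integer.\<close>

locale continued_fraction =
  fixes a :: "nat \<Rightarrow> int" and x :: "nat \<Rightarrow> real"
  assumes x_step: "x n = of_int (a n) + 1 / x (Suc n)"
    and x_gt_1: "1 < x (Suc n)"
begin

text \<open>Indices are shifted by one: \<open>num (n + 1) / den (n + 1)\<close> is the convergent
  \<open>[a 0; \<dots>, a n]\<close>, so that no negative index is needed.\<close>

fun num :: "nat \<Rightarrow> int" where
  "num 0 = 1"
| "num (Suc 0) = a 0"
| "num (Suc (Suc n)) = a (Suc n) * num (Suc n) + num n"

fun den :: "nat \<Rightarrow> int" where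
  "den 0 = 0"
| "den (Suc 0) = 1"
| "den (Suc (Suc n)) = a (Suc n) * den (Suc n) + den n"

definition err :: "nat \<Rightarrow> real" where
  "err n = den n * x 0 - num n"

text \<open>\<open>left n\<close> is \<open>[0; a (n - 1), \<dots>, a 1]\<close> and \<open>right n\<close> is \<open>[0; a n, a (n + 1), \<dots>]\<close>.\<close>

definition left :: "nat \<Rightarrow> real" where
  "left n = den (n - 1) / den n"

definition right :: "nat \<Rightarrow> real" where
  "right n = 1 / x n"

definition lam :: "nat \<Rightarrow> real" where
  "lam n = a n + right (Suc n) + left n"

section \<open>Denominators, approximation errors and Perron's formula\<close>

lemma a_ge_1: "1 \<le> a (Suc n)"
proof -
  have "1 / x (Suc (Suc n)) < 1"
    using x_gt_1[of "Suc n"] by simp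
  then have "0 < real_of_int (a (Suc n))"
    using x_step[of "Suc n"] x_gt_1[of n] by linarith
  then show ?thesis by simp
qed

lemma den_ge:
  "1 \<le> den (Suc n) \<and> int n \<le> den (Suc n) \<and> 0 \<le> den n \<and> den n \<le> den (Suc n) \<and> (n \<noteq> 0 \<longrightarrow> 1 \<le> den n)"
proof (induction n)
  case (Suc n)
  have "1 * den (Suc n) \<le> a (Suc n) * den (Suc n)"
    using a_ge_1[of n] Suc by (intro mult_right_mono) auto
  then have "den (Suc n) + den n \<le> den (Suc (Suc n))"
    by simp
  then show ?case
    using Suc by (cases "n = 0") (auto simp del: den.simps)
qed simp

lemma den_pos: "0 < n \<Longrightarrow> 1 \<le> den n"
  using den_ge by (cases n) auto

lemma det: "num (Suc n) * den n - num n * den (Suc n) = (- 1) ^ Suc n"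
proof (induction n)
  case (Suc n)
  have "num (Suc (Suc n)) * den (Suc n) - num (Suc n) * den (Suc (Suc n))
      = - (num (Suc n) * den n - num n * den (Suc n))"
    by (simp add: algebra_simps)
  then show ?case using Suc by simp
qed simp

text \<open>The errors inherit the recurrence of \<open>num\<close> and \<open>den\<close>, and
  \<open>a n - x n = - 1 / x (Suc n)\<close>. It follows that errors never vanish and alternate in
  sign.\<close>

lemma err_Suc: "err (Suc n) * x (Suc n) = - err n"
proof (induction n)
  case 0
  have "x 0 = a 0 + 1 / x 1"
    using x_step[of 0] by simp
  then show ?case using x_gt_1[of 0] by (simp add: err_def)
next
  case (Suc n)
  have "err (Suc (Suc n)) = a (Suc n) * err (Suc n) + err n"
    by (simp add: err_def algebra_simps)
  also have "\<dots> = (a (Suc n) - x (Suc n)) * err (Suc n)"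
    using Suc by (simp add: algebra_simps)
  also have "\<dots> = - err (Suc n) / x (Suc (Suc n))"
    using x_step[of "Suc n"] by simp
  finally show ?case
    using x_gt_1[of "Suc n"] by simp
qed

lemma err_nonzero: "err n \<noteq> 0"
proof (induction n)
  case (Suc n)
  then show ?case using err_Suc[of n] by auto
qed (simp add: err_def)

lemma err_alternating: "err n * err (Suc n) < 0"
proof -
  have e: "err n = - (err (Suc n) * x (Suc n))"
    using err_Suc[of n] by simp
  have "err n * err (Suc n) = - (err (Suc n))\<^sup>2 * x (Suc n)"
    unfolding e by (simp add: power2_eq_square)
  also have "\<dots> < 0"
    using err_nonzero[of "Suc n"] x_gt_1[of n] by simp
  finally show ?thesis .
qed

lemma left_nonneg: "0 \<le> left n"
  using den_ge[of "n - 1"] by (cases n) (auto simp: left_def)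

lemma left_le_1: "left n \<le> 1"
  using den_ge[of "n - 1"] by (cases n) (auto simp: left_def)

lemma left_Suc: "0 < n \<Longrightarrow> left (Suc n) = 1 / (a n + left n)"
proof (cases n)
  case (Suc m)
  have "1 \<le> den (Suc m)" using den_ge by blast
  then show ?thesis
    by (simp add: left_def Suc field_simps)
qed simp

lemma right_pos: "0 < n \<Longrightarrow> 0 < right n"
  using x_gt_1[of "n - 1"] by (simp add: right_def)

lemma right_less_1: "0 < n \<Longrightarrow> right n < 1"
  using x_gt_1[of "n - 1"] by (simp add: right_def)

lemma right_unfold: "right n = 1 / (a n + right (Suc n))"
  using x_step[of n] by (simp add: right_def)

lemma lam_eq: "lam n = x n + left n"
  using x_step[of n] by (simp add: lam_def right_def)

lemma lam_gt_1: "0 < n \<Longrightarrow> 1 < lam n"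
  using x_gt_1[of "n - 1"] left_nonneg[of n] by (simp add: lam_eq)

text \<open>Expanding \<open>err n * den n * (x n + left n)\<close> with \<open>err_Suc\<close>
  leaves, up to sign, the determinant of two consecutive convergents.\<close>

lemma perron_formula:
  assumes "0 < n"
  shows "\<bar>den n * err n\<bar> = 1 / lam n"
proof -
  obtain m where n: "n = Suc m" using assms by (cases n) auto
  have d: "1 \<le> den (Suc m)" using den_ge by blast
  have e: "err m = - (err (Suc m) * x (Suc m))"
    using err_Suc[of m] by simp
  have "err (Suc m) * den (Suc m) * lam (Suc m) = err (Suc m) * den m - err m * den (Suc m)"
    using d unfolding lam_eq left_def e by (simp add: field_simps)
  also have "\<dots> = - real_of_int (num (Suc m) * den m - num m * den (Suc m))"
    by (simp add: err_def algebra_simps)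
  also have "\<dots> = (- 1) ^ m"
    unfolding det by simp
  finally have "\<bar>err (Suc m) * den (Suc m) * lam (Suc m)\<bar> = 1"
    by (simp add: power_abs)
  then show ?thesis
    using lam_gt_1[of "Suc m"] by (simp add: n abs_mult field_simps)
qed

text \<open>If \<open>x 0 = A / B\<close>, then \<open>B * err n\<close> is a nonzero integer, yet
  \<open>B < den n\<close> makes it smaller than 1 in absolute value.\<close>

lemma irrational: "x 0 \<notin> \<rat>"
proof
  assume "x 0 \<in> \<rat>"
  then obtain A B :: int where B: "0 < B" and AB: "x 0 = A / B"
    by (auto elim!: Rats_cases')
  define n where "n = Suc (Suc (nat B))"
  have den: "B + 1 \<le> den n"
    using den_ge[of "Suc (nat B)"] B by (simp add: n_def)
  have eq: "real_of_int B * err n = of_int (den n * A - num n * B)"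
    using B by (simp add: err_def AB field_simps)
  have "real_of_int B * err n \<noteq> 0"
    using err_nonzero[of n] B by simp
  then have "den n * A - num n * B \<noteq> 0"
    unfolding eq by (simp only: of_int_eq_0_iff not_False_eq_True)
  then have "1 \<le> \<bar>real_of_int (den n * A - num n * B)\<bar>"
    by linarith
  then have "1 \<le> \<bar>real_of_int B * err n\<bar>"
    by (simp only: eq)
  moreover have "\<bar>den n * err n\<bar> < 1"
    using perron_formula[of n] lam_gt_1[of n] by (simp add: n_def)
  moreover have "\<bar>real_of_int B * err n\<bar> \<le> \<bar>den n * err n\<bar>"
    using den B by (simp add: abs_mult mult_right_mono)
  ultimately show False by simp
qed

text \<open>Consecutive convergents form a unimodular basis, so \<open>(p, q)\<close> has integer
  coordinates \<open>u\<close>, \<open>v\<close> in it. The size of \<open>q\<close> forces opposite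
  signs on them; as the errors alternate too, the two contributions to \<open>q * x 0 - p\<close> do
  not cancel.\<close>

lemma best_approximation:
  fixes p q :: int
  assumes "0 < n" "0 < q" "q < den (Suc n)" and ne: "p * den n \<noteq> q * num n"
  shows "\<bar>err n\<bar> \<le> \<bar>q * x 0 - p\<bar>"
proof -
  define d :: int where "d = (- 1) ^ Suc n"
  \<comment> \<open>Cramer's rule; the determinant \<open>d\<close> is its own inverse.\<close>
  define u v where "u = d * (q * num (Suc n) - p * den (Suc n))"
    and "v = d * (p * den n - q * num n)"
  have dd: "d * d = 1"
    by (simp add: d_def flip: power_mult_distrib)
  have det': "num (Suc n) * den n - num n * den (Suc n) = d"
    by (simp only: det d_def)
  have "u * num n + v * num (Suc n) = d * p * (num (Suc n) * den n - num n * den (Suc n))"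
    by (simp add: u_def v_def algebra_simps)
  also have "\<dots> = d * d * p"
    unfolding det' by (simp only: ac_simps)
  finally have p: "u * num n + v * num (Suc n) = p"
    by (simp add: dd)
  have "u * den n + v * den (Suc n) = d * q * (num (Suc n) * den n - num n * den (Suc n))"
    by (simp add: u_def v_def algebra_simps)
  also have "\<dots> = d * d * q"
    unfolding det' by (simp only: ac_simps)
  finally have q: "u * den n + v * den (Suc n) = q"
    by (simp add: dd)
  have d0: "1 \<le> den n" and d1: "1 \<le> den (Suc n)"
    using assms(1) den_pos by auto
  have "v \<noteq> 0"
    using ne dd by (auto simp: v_def)
  have "u * v < 0"
  proof (rule ccontr)
    assume "\<not> u * v < 0"
    then consider "0 \<le> u" "0 < v" | "u \<le> 0" "v < 0"
      using \<open>v \<noteq> 0\<close> by (auto simp: mult_less_0_iff not_less) (meson linorder_neqE_linordered_idom)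
    then show False
    proof cases
      case 1
      then have "0 \<le> u * den n" "1 * den (Suc n) \<le> v * den (Suc n)"
        using d0 d1 by (auto intro!: mult_right_mono simp del: den.simps)
      then show False using q assms(3) by simp
    next
      case 2
      then have "u * den n \<le> 0" "v * den (Suc n) \<le> 0"
        using d0 d1 by (auto simp: mult_le_0_iff simp del: den.simps)
      then show False using q assms(2) by simp
    qed
  qed
  have eq: "q * x 0 - p = u * err n + v * err (Suc n)"
    by (simp add: err_def algebra_simps flip: p q)
  have "(u * err n) * (v * err (Suc n)) = real_of_int (u * v) * (err n * err (Suc n))"
    by simp
  also have "\<dots> > 0"
    using \<open>u * v < 0\<close> err_alternating by (intro mult_neg_neg) (simp_all only: of_int_less_0_iff)
  finally have same_sign: "0 < (u * err n) * (v * err (Suc n))" .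
  have "\<bar>y\<bar> \<le> \<bar>y + z\<bar>" if "0 < y * z" for y z :: real
    using that by (auto simp: zero_less_mult_iff)
  from this[OF same_sign] have "\<bar>u * err n\<bar> \<le> \<bar>u * err n + v * err (Suc n)\<bar>" .
  moreover have "1 * \<bar>err n\<bar> \<le> \<bar>real_of_int u\<bar> * \<bar>err n\<bar>"
    using \<open>u * v < 0\<close> by (intro mult_right_mono) (cases u rule: int_cases3, auto)
  ultimately show ?thesis
    unfolding eq by (simp add: abs_mult)
qed

text \<open>Choose \<open>m\<close> with \<open>den m \<le> q < den (Suc m)\<close>. If
  \<open>p / q\<close> differed from \<open>num m / den m\<close>, best approximation would bound
  the nonzero integer \<open>p * den m - q * num m\<close> by a number below 1. The conclusion
  equates fractions because \<open>p\<close> and \<open>q\<close> need not be coprime.\<close>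

lemma legendre:
  fixes p q :: int
  assumes "0 < q" and small: "\<bar>q * (q * x 0 - p)\<bar> < 1 / 2"
  obtains n where "0 < n" "p * den n = q * num n"
proof -
  have ex: "q < den (Suc (Suc (nat q)))"
    using den_ge[of "Suc (nat q)"] assms(1) by linarith
  define m where "m = (LEAST m. q < den (Suc m))"
  have m: "q < den (Suc m)"
    unfolding m_def using ex by (rule LeastI)
  have "m \<noteq> 0"
    using m assms(1) by (cases m) auto
  then obtain l where l: "m = Suc l" by (cases m) auto
  have le: "den m \<le> q"
    using not_less_Least[of l "\<lambda>m. q < den (Suc m)"] by (fold m_def) (simp add: l)
  have "p * den m = q * num m"
  proof (rule ccontr)
    assume ne: "p * den m \<noteq> q * num m"
    have dm: "1 \<le> den m" using \<open>m \<noteq> 0\<close> den_pos by simp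
    define E where "E = \<bar>q * x 0 - p\<bar>"
    have "\<bar>err m\<bar> \<le> E"
      unfolding E_def using best_approximation[OF _ assms(1) m ne] \<open>m \<noteq> 0\<close> by simp
    have qE: "q * E < 1 / 2"
      using small assms(1) by (simp add: E_def abs_mult)
    have "1 \<le> \<bar>p * den m - q * num m\<bar>"
      using ne by linarith
    then have "1 \<le> \<bar>real_of_int (p * den m - q * num m)\<bar>"
      by linarith
    also have "real_of_int (p * den m - q * num m) = q * err m - den m * (q * x 0 - p)"
      by (simp add: err_def algebra_simps)
    also have "\<bar>\<dots>\<bar> \<le> q * \<bar>err m\<bar> + den m * E"
      using abs_triangle_ineq4[of "q * err m" "den m * (q * x 0 - p)"] assms(1) dm
      by (simp add: E_def abs_mult)
    also have "\<dots> \<le> q * E + q * E"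
      using \<open>\<bar>err m\<bar> \<le> E\<close> le assms(1)
      by (intro add_mono mult_left_mono mult_right_mono) (auto simp: E_def)
    finally show False using qE by (simp add: ac_simps)
  qed
  then show thesis using that \<open>m \<noteq> 0\<close> by blast
qed

text \<open>By Legendre's criterion a solution is \<open>k\<close> times a convergent pair, and
  Perron's formula gives \<open>k^2 * c \<le> lam n\<close>. This leaves only indices with
  \<open>c \<le> lam n\<close> and then bounds \<open>k\<close> as well.\<close>

lemma finite_good_approximations:
  assumes c: "2 < c" and ev: "\<forall>\<^sub>F n in sequentially. lam n < c"
  shows "finite {(p :: int, q :: nat). q > 0 \<and> \<bar>real q * (real q * x 0 - p)\<bar> \<le> 1 / c}"
    (is "finite ?S")
proof -
  obtain M where M: "\<And>n. M \<le> n \<Longrightarrow> lam n < c"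
    using ev by (auto simp: eventually_sequentially)
  define f where "f = (\<lambda>(n, k). (k * num n, nat (k * den n)))"
  \<comment> \<open>The sum is one bound for \<open>k\<close> that serves all
    \<open>n < M\<close>.\<close>
  have "?S \<subseteq> f ` ({..<M} \<times> {0..(\<Sum>n<M. \<lceil>\<bar>lam n\<bar>\<rceil>)})"
  proof clarify
    fix p :: int and q :: nat
    assume q: "0 < q" and le: "\<bar>real q * (real q * x 0 - p)\<bar> \<le> 1 / c"
    have "1 / c < 1 / 2" using c by (intro divide_strict_left_mono) auto
    then have "\<bar>int q * (int q * x 0 - p)\<bar> < 1 / 2"
      using le by simp
    then obtain n where n: "0 < n" and pq: "p * den n = int q * num n"
      using legendre[of "int q" p] q by auto
    have dn: "1 \<le> den n" using n den_pos by simp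
    obtain m where m: "n = Suc m" using n by (cases n) auto
    have "coprime (num n) (den n)"
    proof (rule coprimeI)
      fix g assume "g dvd num n" "g dvd den n"
      then have "g dvd num (Suc m) * den m - num m * den (Suc m)"
        by (simp add: m del: num.simps den.simps)
      then show "is_unit g"
        unfolding det by (rule dvd_trans) simp
    qed
    moreover have "den n dvd int q * num n"
      by (metis pq dvd_triv_right)
    ultimately have "den n dvd int q"
      by (simp add: coprime_commute coprime_dvd_mult_left_iff)
    then obtain k where k: "int q = k * den n"
      by (metis dvd_def mult.commute)
    have p: "p = k * num n"
      using pq dn by (simp add: k)
    have k1: "1 \<le> k"
      using q k dn by (metis int_one_le_iff_zero_less of_nat_0_less_iff zero_less_mult_pos2 order_less_le_trans zero_less_one)
    have rq: "real q = of_int k * of_int (den n)"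
      using k by (metis of_int_mult of_int_of_nat_eq)
    have "real q * (real q * x 0 - p) = (of_int k)\<^sup>2 * (den n * err n)"
      by (simp add: rq p err_def power2_eq_square algebra_simps)
    then have "(of_int k)\<^sup>2 / lam n \<le> 1 / c"
      using le n by (simp add: abs_mult[of "(of_int k)\<^sup>2"] perron_formula)
    then have kc: "(of_int k)\<^sup>2 * c \<le> lam n"
      using c lam_gt_1[OF n] by (simp add: field_simps)
    have "real_of_int k * 1 \<le> of_int k * of_int k"
      using k1 by (intro mult_left_mono) auto
    then have kk: "real_of_int k \<le> (of_int k)\<^sup>2"
      by (simp add: power2_eq_square)
    then have "1 \<le> (real_of_int k)\<^sup>2" using k1 by linarith
    then have "1 * c \<le> (of_int k)\<^sup>2 * c"
      using c by (intro mult_right_mono) auto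
    moreover have "(real_of_int k)\<^sup>2 * 1 \<le> (of_int k)\<^sup>2 * c"
      using c by (intro mult_left_mono) auto
    ultimately have "c \<le> lam n" and "real_of_int k \<le> lam n"
      using kc kk by linarith+
    then have nM: "n < M" and "k \<le> \<lceil>\<bar>lam n\<bar>\<rceil>"
      using M[of n] by (force, linarith)
    moreover have "\<lceil>\<bar>lam n\<bar>\<rceil> \<le> (\<Sum>n<M. \<lceil>\<bar>lam n\<bar>\<rceil>)"
    proof (rule member_le_sum)
      show "0 \<le> \<lceil>\<bar>lam i\<bar>\<rceil>" for i
        using abs_ge_zero[of "lam i"] by linarith
    qed (use nM in auto)
    ultimately have "(n, k) \<in> {..<M} \<times> {0..(\<Sum>n<M. \<lceil>\<bar>lam n\<bar>\<rceil>)}"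
      using k1 by auto
    moreover have "(p, q) = f (n, k)"
      by (simp add: f_def p flip: k)
    ultimately show "(p, q) \<in> f ` ({..<M} \<times> {0..(\<Sum>n<M. \<lceil>\<bar>lam n\<bar>\<rceil>)})"
      by blast
  qed
  then show ?thesis by (rule finite_subset) auto
qed

end

section \<open>Forbidden words\<close>

text \<open>The number \<open>[0; 1, 2, 1, 2, \<dots>]\<close>.\<close>

definition theta :: real where
  "theta = sqrt 3 - 1"

text \<open>\<open>[0; 2, 1 + s]\<close> and \<open>[0; 3, 3, 2, 1 + s]\<close> in reduced form.\<close>

definition short_tail :: "real \<Rightarrow> real" where
  "short_tail s = (1 + s) / (3 + 2 * s)"

definition long_tail :: "real \<Rightarrow> real" where
  "long_tail s = (10 + 7 * s) / (33 + 23 * s)"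

section \<open>Estimates for the extremal tails\<close>

lemma theta_bounds: "183 / 250 < theta" "theta < 7321 / 10000"
proof -
  have "1.732 < sqrt 3" by (rule real_less_rsqrt) (simp add: power2_eq_square)
  moreover have "sqrt 3 < 1.7321" by (rule real_less_lsqrt) (simp_all add: power2_eq_square)
  ultimately show "183 / 250 < theta" "theta < 7321 / 10000" by (simp_all add: theta_def)
qed

lemma theta_fixed_point: "theta * (3 + theta) = 2 + theta"
  by (simp add: theta_def algebra_simps)

text \<open>One period \<open>1 2\<close> acts as \<open>(2 + y) / (3 + y)\<close>, with fixed point
  \<open>theta\<close>. The exact difference shows that it preserves the side of
  \<open>theta\<close> and shrinks the distance at least ninefold; both facts are used
  later.\<close>

lemma theta_step:
  assumes "0 \<le> y"
  shows "1 / (1 + 1 / (2 + y)) - theta = (y - theta) / ((3 + y) * (3 + theta))"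
proof -
  have "1 / (1 + 1 / (2 + y)) = (2 + y) / (3 + y)"
    using assms by (simp add: divide_simps)
  moreover have "(2 + y) / (3 + y) - (2 + theta) / (3 + theta) = (y - theta) / ((3 + y) * (3 + theta))"
    using assms theta_bounds by (subst diff_frac_eq) (auto simp: algebra_simps)
  moreover have "(2 + theta) / (3 + theta) = theta"
    using theta_fixed_point theta_bounds by (simp add: divide_eq_eq)
  ultimately show ?thesis by simp
qed

lemma theta_step_abs:
  assumes "0 \<le> y"
  shows "\<bar>1 / (1 + 1 / (2 + y)) - theta\<bar> \<le> \<bar>y - theta\<bar> / 9"
proof -
  have "\<bar>1 / (1 + 1 / (2 + y)) - theta\<bar> = \<bar>y - theta\<bar> / ((3 + y) * (3 + theta))"
    unfolding theta_step[OF assms] using assms theta_bounds by (simp add: abs_mult)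
  also have "\<dots> \<le> \<bar>y - theta\<bar> / (3 * 3)"
    by (intro divide_left_mono mult_mono) (use assms theta_bounds in auto)
  finally show ?thesis by simp
qed

lemma short_tail_less: "0 \<le> s \<Longrightarrow> s < t \<Longrightarrow> short_tail s < short_tail t"
  by (simp add: short_tail_def divide_simps algebra_simps)

lemma long_tail_less: "0 \<le> s \<Longrightarrow> s < t \<Longrightarrow> long_tail s < long_tail t"
  by (simp add: long_tail_def divide_simps algebra_simps)

lemma short_tail_theta_gt: "3879 / 10000 < short_tail theta"
proof -
  have "3879 / 10000 < short_tail (183 / 250)" by (simp add: short_tail_def)
  also have "\<dots> < short_tail theta" using theta_bounds by (intro short_tail_less) auto
  finally show ?thesis .
qed

lemma long_tail_theta_gt: "1517 / 5000 < long_tail theta"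
proof -
  have "1517 / 5000 < long_tail (183 / 250)" by (simp add: long_tail_def)
  also have "\<dots> < long_tail theta" using theta_bounds by (intro long_tail_less) auto
  finally show ?thesis .
qed

lemma tail_sum_less: "3 + long_tail theta + short_tail theta < 923 / 250"
proof -
  have "short_tail theta < short_tail (7321 / 10000)" "long_tail theta < long_tail (7321 / 10000)"
    using theta_bounds by (auto intro: short_tail_less long_tail_less)
  moreover have "3 + long_tail (7321 / 10000) + short_tail (7321 / 10000) < 923 / 250"
    by (simp add: short_tail_def long_tail_def)
  ultimately show ?thesis by linarith
qed

lemma short_tail_unfold: "0 \<le> y \<Longrightarrow> 1 / (2 + 1 / (1 + y)) = short_tail y"
  by (simp add: short_tail_def divide_simps)

lemma long_tail_unfold:
  assumes "0 \<le> y"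
  shows "1 / (3 + 1 / (3 + 1 / (2 + 1 / (1 + y)))) = long_tail y"
proof -
  have "1 / (3 + short_tail y) = (3 + 2 * y) / (10 + 7 * y)"
    using assms by (simp add: short_tail_def divide_simps)
  then show ?thesis
    using assms by (simp add: short_tail_unfold long_tail_def divide_simps)
qed

text \<open>A tail starting with the digit \<open>3\<close> that continues with \<open>2\<close> or \<open>3\<close> is largest for
  \<open>[0; 3, 3, 2, 1, 1, 2, 1, 2, \<dots>]\<close>.\<close>

lemma long_tail_bound:
  fixes b2 b3 b4 :: int and y0 y1 y2 y3 y4 :: real
  assumes y: "y0 = 1 / (3 + y1)" "y1 = 1 / (b2 + y2)" "y2 = 1 / (b3 + y3)" "y3 = 1 / (b4 + y4)"
    and b: "b2 = 2 \<or> b2 = 3" "b2 = 3 \<Longrightarrow> b3 = 2 \<or> b3 = 3" "b2 = 3 \<Longrightarrow> b3 = 2 \<Longrightarrow> b4 = 1"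
    and bounds: "1 / 4 \<le> y2" "y2 \<le> theta" "1 / 4 \<le> y3" "1 / 4 \<le> y4" "y4 \<le> theta"
  shows "y0 \<le> long_tail theta" and "y4 < theta \<Longrightarrow> y0 < long_tail theta"
proof -
  \<comment> \<open>Tails starting with \<open>32\<close> or \<open>333\<close> fall below
    \<open>long_tail theta\<close> by crude bounds; only \<open>3321\<close> competes.\<close>
  consider "b2 = 2" | "b2 = 3" "b3 = 3" | "b2 = 3" "b3 = 2" "b4 = 1"
    using b by auto
  then have "y0 \<le> long_tail theta \<and> (y4 < theta \<longrightarrow> y0 < long_tail theta)"
  proof cases
    case 1
    have "1 / 2.7321 \<le> y1"
      unfolding y(2) 1 by (intro frac_le) (use bounds theta_bounds in auto)
    then have "y0 \<le> 1 / (3 + 1 / 2.7321)"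
      unfolding y(1) by (intro frac_le) auto
    also have "\<dots> < 1517 / 5000" by simp
    finally show ?thesis using long_tail_theta_gt by simp
  next
    case 2
    have "y2 \<le> 1 / 3.25"
      unfolding y(3) 2 by (intro frac_le) (use bounds in auto)
    then have "1 / (3 + 1 / 3.25) \<le> y1"
      unfolding y(2) 2 by (intro frac_le) (use bounds in auto)
    then have "y0 \<le> 1 / (3 + 1 / (3 + 1 / 3.25))"
      unfolding y(1) by (intro frac_le) auto
    also have "\<dots> < 1517 / 5000" by simp
    finally show ?thesis using long_tail_theta_gt by simp
  next
    case 3
    have "y0 = long_tail y4"
      using long_tail_unfold[of y4] bounds by (simp add: y 3)
    then show ?thesis
      using long_tail_less[of y4 theta] bounds by (cases "y4 = theta") auto
  qed
  then show "y0 \<le> long_tail theta" and "y4 < theta \<Longrightarrow> y0 < long_tail theta"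
    by auto
qed

text \<open>The last two clauses exclude \<open>223\<close>, \<open>323\<close> and
  \<open>322\<close> in the form of a forced digit \<open>1\<close>, which is how they extend a
  known word.\<close>

definition admissible_at :: "(nat \<Rightarrow> int) \<Rightarrow> nat \<Rightarrow> bool" where
  "admissible_at a n \<longleftrightarrow>
     a n \<in> {1, 2, 3} \<and>
     (a n = 1 \<longrightarrow> a (Suc n) \<noteq> 3) \<and>
     (a n = 3 \<longrightarrow> a (Suc n) \<noteq> 1) \<and>
     (a n = 2 \<longrightarrow> a (Suc n) = 3 \<longrightarrow> a (Suc (Suc n)) \<noteq> 2) \<and>
     (a (Suc n) = 2 \<longrightarrow> a (Suc (Suc n)) = 3 \<longrightarrow> a n = 1) \<and>
     (a n = 3 \<longrightarrow> a (Suc n) = 2 \<longrightarrow> a (Suc (Suc n)) = 1)"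

definition admissible :: "(nat \<Rightarrow> int) \<Rightarrow> nat \<Rightarrow> bool" where
  "admissible a N \<longleftrightarrow> (\<forall>n\<ge>N. admissible_at a n)"

lemma admissibleD:
  assumes "admissible a N" "N \<le> n"
  shows "a n = 1 \<or> a n = 2 \<or> a n = 3"
    and "a n = 1 \<Longrightarrow> a (Suc n) \<noteq> 3"
    and "a n = 3 \<Longrightarrow> a (Suc n) \<noteq> 1"
    and "a n = 2 \<Longrightarrow> a (Suc n) = 3 \<Longrightarrow> a (Suc (Suc n)) \<noteq> 2"
    and "a (Suc n) = 2 \<Longrightarrow> a (Suc (Suc n)) = 3 \<Longrightarrow> a n = 1"
    and "a n = 3 \<Longrightarrow> a (Suc n) = 2 \<Longrightarrow> a (Suc (Suc n)) = 1"
proof -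
  have "admissible_at a n" using assms by (simp add: admissible_def)
  then show "a n = 1 \<or> a n = 2 \<or> a n = 3"
    and "a n = 1 \<Longrightarrow> a (Suc n) \<noteq> 3"
    and "a n = 3 \<Longrightarrow> a (Suc n) \<noteq> 1"
    and "a n = 2 \<Longrightarrow> a (Suc n) = 3 \<Longrightarrow> a (Suc (Suc n)) \<noteq> 2"
    and "a (Suc n) = 2 \<Longrightarrow> a (Suc (Suc n)) = 3 \<Longrightarrow> a n = 1"
    and "a n = 3 \<Longrightarrow> a (Suc n) = 2 \<Longrightarrow> a (Suc (Suc n)) = 1"
    unfolding admissible_at_def by simp_all
qed

lemma admissible_mono: "admissible a N \<Longrightarrow> N \<le> N' \<Longrightarrow> admissible a N'"
  by (simp add: admissible_def)

section \<open>Tails of expansions without forbidden words\<close>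

context continued_fraction
begin

text \<open>The first of four rules that carry a bound across one digit, so that tails are estimated
  from the inside out.\<close>

lemma right_ge: "0 < n \<Longrightarrow> a n + right (Suc n) \<le> z \<Longrightarrow> 1 / z \<le> right n"
  using a_ge_1[of "n - 1"] right_pos[of "Suc n"] by (subst right_unfold, intro frac_le) auto

lemma right_le: "0 < z \<Longrightarrow> z \<le> a n + right (Suc n) \<Longrightarrow> right n \<le> 1 / z"
  by (subst right_unfold, intro frac_le) auto

lemma left_ge: "0 < n \<Longrightarrow> a n + left n \<le> z \<Longrightarrow> 1 / z \<le> left (Suc n)"
  using a_ge_1[of "n - 1"] left_nonneg[of n] by (subst left_Suc, simp, intro frac_le) auto

lemma left_le: "0 < n \<Longrightarrow> 0 < z \<Longrightarrow> z \<le> a n + left n \<Longrightarrow> left (Suc n) \<le> 1 / z"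
  by (subst left_Suc, simp, intro frac_le) auto

lemma right_bounds:
  assumes "0 < n" "a n \<le> 3" "a (Suc n) \<le> 3"
  shows "1 / 4 \<le> right n" "right n \<le> 4 / 5"
proof -
  have lower: "1 / 4 \<le> right m" if "0 < m" "a m \<le> 3" for m
  proof -
    have "0 < right (Suc m)" "right (Suc m) < 1"
      using right_pos right_less_1 by auto
    moreover have "0 < a m" using a_ge_1[of "m - 1"] that by simp
    ultimately show ?thesis
      unfolding right_unfold[of m] using that by (intro frac_le) auto
  qed
  show "1 / 4 \<le> right n" using lower assms by blast
  have "1 \<le> a n" using a_ge_1[of "n - 1"] assms by simp
  then have "5 / 4 \<le> a n + right (Suc n)"
    using lower[of "Suc n"] assms by simp
  then have "1 / (a n + right (Suc n)) \<le> 1 / (5 / 4)"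
    by (intro frac_le) auto
  then show "right n \<le> 4 / 5"
    unfolding right_unfold[of n] by simp
qed

text \<open>Since \<open>left 1 = 0\<close>, the lower bound needs one digit behind the position and
  the upper bound two; hence the shift by two.\<close>

lemma left_bounds:
  assumes "0 < n" "a n \<le> 3" "a (Suc n) \<le> 3"
  shows "1 / 4 \<le> left (Suc (Suc n))" "left (Suc (Suc n)) \<le> 4 / 5"
proof -
  have lower: "1 / 4 \<le> left (Suc m)" if "0 < m" "a m \<le> 3" for m
  proof -
    have "0 < a m" using a_ge_1[of "m - 1"] that by simp
    then show ?thesis
      unfolding left_Suc[OF that(1)] using that left_nonneg[of m] left_le_1[of m]
      by (intro frac_le) auto
  qed
  show "1 / 4 \<le> left (Suc (Suc n))" using lower assms by blast
  have "5 / 4 \<le> a (Suc n) + left (Suc n)"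
    using lower[of n] assms a_ge_1[of n] by simp
  then have "1 / (a (Suc n) + left (Suc n)) \<le> 1 / (5 / 4)"
    by (intro frac_le) auto
  then show "left (Suc (Suc n)) \<le> 4 / 5"
    by (simp add: left_Suc)
qed

text \<open>The bound \<open>923 / 250\<close> lies between \<open>\<lambda>\<^sub>0 = 3.69147\<dots>\<close> and the least value of \<open>lam\<close>
  inside a forbidden word.\<close>

lemma admissible_of_lam_less:
  assumes small: "\<And>n. M \<le> n \<Longrightarrow> lam n < 923 / 250"
  shows "admissible a (M + 5)"
proof -
  have a_pos: "1 \<le> a n" if "M + 1 \<le> n" for n
    using a_ge_1[of "n - 1"] that by simp
  have a_le: "a n \<le> 3" if "M + 1 \<le> n" for n
    using small[of n] that right_pos[of "Suc n"] left_nonneg[of n] by (simp add: lam_def)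
  have r: "1 / 4 \<le> right n" "right n \<le> 4 / 5" if "M + 1 \<le> n" for n
    using right_bounds[of n] a_le[of n] a_le[of "Suc n"] that by auto
  have l: "1 / 4 \<le> left n" "left n \<le> 4 / 5" if "M + 3 \<le> n" for n
    using left_bounds[of "n - 2"] a_le[of "n - 2"] a_le[of "n - 1"] that
    by (auto simp: Suc_diff_le numeral_2_eq_2 Suc_diff_Suc)
  \<comment> \<open>At the \<open>3\<close> the tails are at least \<open>1 / (1 + 4 / 5)\<close>
    and \<open>1 / 4\<close>. The mirrored estimate excludes \<open>31\<close>.\<close>
  have no13: "a (Suc n) \<noteq> 3" if n: "M + 3 \<le> n" "a n = 1" for n
  proof
    assume 3: "a (Suc n) = 3"
    have "1 / 1.8 \<le> left (Suc n)"
      using l[of n] n by (intro left_ge) (auto)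
    then show False
      using small[of "Suc n"] r[of "Suc (Suc n)"] n by (simp add: lam_def 3)
  qed
  have no31: "a (Suc n) \<noteq> 1" if n: "M + 3 \<le> n" "a n = 3" for n
  proof
    assume 1: "a (Suc n) = 1"
    have "1 / 1.8 \<le> right (Suc n)"
      using r[of "Suc (Suc n)"] n by (intro right_ge) (auto simp: 1)
    then show False
      using small[of n] l[of n] n by (simp add: lam_def)
  qed
  \<comment> \<open>Both tails at the \<open>3\<close> are at least \<open>1 / (2 + 4 / 5)\<close>,
    for a total above \<open>3.71\<close>.\<close>
  have no232: "a (Suc (Suc n)) \<noteq> 2" if n: "M + 3 \<le> n" "a n = 2" "a (Suc n) = 3" for n
  proof
    assume 2: "a (Suc (Suc n)) = 2"
    have "1 / 2.8 \<le> left (Suc n)"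
      using l[of n] n by (intro left_ge) (auto)
    moreover have "1 / 2.8 \<le> right (Suc (Suc n))"
      using r[of "Suc (Suc (Suc n))"] n by (intro right_ge) (auto simp: 2)
    ultimately show False
      using small[of "Suc n"] n by (simp add: lam_def)
  qed
  have digit: "a n = 1 \<or> a n = 2 \<or> a n = 3" if "M + 1 \<le> n" for n
    using a_le[of n] a_pos[of n] that by auto
  \<comment> \<open>Otherwise the word is \<open>x 2 3 3 y\<close> with \<open>x\<close> and
    \<open>y\<close> at least 2, and \<open>1 / (2 + 1 / 4)\<close> bounds the tails starting there.
    The total at the first \<open>3\<close> exceeds \<open>3.699\<close>, the tightest of these
    estimates.\<close>
  have before23: "a n = 1" if n: "M + 3 \<le> n" "a (Suc n) = 2" "a (Suc (Suc n)) = 3" for n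
  proof (rule ccontr)
    assume "a n \<noteq> 1"
    then have 2: "2 \<le> a n" using digit[of n] n by auto
    have 3: "a (Suc (Suc (Suc n))) = 3"
      using no31[of "Suc (Suc n)"] no232[of "Suc n"] digit[of "Suc (Suc (Suc n))"] n by auto
    then have 4: "2 \<le> a (Suc (Suc (Suc (Suc n))))"
      using no31[of "Suc (Suc (Suc n))"] digit[of "Suc (Suc (Suc (Suc n)))"] n by auto
    have "right (Suc (Suc (Suc (Suc n)))) \<le> 1 / 2.25"
      using r[of "Suc (Suc (Suc (Suc (Suc n))))"] n 4 by (intro right_le) (auto)
    then have "1 / (3 + 1 / 2.25) \<le> right (Suc (Suc (Suc n)))"
      using r[of "Suc (Suc (Suc (Suc n)))"] n by (intro right_ge) (auto simp: 3)
    moreover have "left (Suc n) \<le> 1 / 2.25"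
      using l[of n] n 2 by (intro left_le) (auto)
    then have "1 / (2 + 1 / 2.25) \<le> left (Suc (Suc n))"
      using l[of "Suc n"] n by (intro left_ge) (auto)
    ultimately show False
      using small[of "Suc (Suc n)"] n by (simp add: lam_def)
  qed
  have after32: "a (Suc (Suc n)) = 1" if n: "M + 5 \<le> n" "a n = 3" "a (Suc n) = 2" for n
  proof (rule ccontr)
    assume "a (Suc (Suc n)) \<noteq> 1"
    then have 2: "2 \<le> a (Suc (Suc n))" using digit[of "Suc (Suc n)"] n by auto
    \<comment> \<open>The mirrored argument looks two digits back, and the bounds on
      \<open>left\<close> begin at \<open>M + 3\<close>; hence the offset
      \<open>M + 5\<close>.\<close>
    obtain m where m: "n = Suc (Suc m)" "M + 3 \<le> m"
      using n(1) that[of "n - 2"] by simp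
    have 3: "a (Suc m) = 3"
      using no13[of "Suc m"] no232[of "Suc m"] digit[of "Suc m"] n m by auto
    then have 4: "2 \<le> a m"
      using no13[of m] digit[of m] m by auto
    have "left (Suc m) \<le> 1 / 2.25"
      using l[of m] m 4 by (intro left_le) (auto)
    then have "1 / (3 + 1 / 2.25) \<le> left (Suc (Suc m))"
      by (intro left_ge) (auto simp: 3)
    moreover have "right (Suc (Suc n)) \<le> 1 / 2.25"
      using r[of "Suc (Suc (Suc n))"] n 2 by (intro right_le) (auto)
    then have "1 / (2 + 1 / 2.25) \<le> right (Suc n)"
      using r[of "Suc (Suc n)"] n by (intro right_ge) (auto)
    ultimately show False
      using small[of n] n by (simp add: lam_def m)
  qed
  have "admissible_at a n" if "M + 5 \<le> n" for n
    unfolding admissible_at_def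
    using that digit[of n] no13[of n] no31[of n] no232[of n] before23[of n] after32[of n]
    by simp
  then show ?thesis by (simp add: admissible_def)
qed

text \<open>A first digit of at least 2 gives at most \<open>1 / 2\<close>, the start
  \<open>11\<close> at most \<open>2 / 3\<close>, and \<open>13\<close> is forbidden. The start
  \<open>12\<close> leads to the same question two digits later, with any excess over
  \<open>theta\<close> divided by at least 9 on the way back; iterating forever leaves no
  excess.\<close>

lemma right_le_theta:
  assumes adm: "admissible a N" and "0 < N" "N \<le> n"
  shows "right n \<le> theta"
proof -
  have "right n - theta \<le> (1 / 9) ^ k" if "N \<le> n" for k n
    using that
  proof (induction k arbitrary: n)
    case 0
    then show ?case using right_less_1[of n] assms(2) theta_bounds by simp
  next
    case (Suc k)
    have n: "0 < n" using Suc.prems assms(2) by simp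
    have p: "0 \<le> (1 / 9 :: real) ^ Suc k" by simp
    have pos: "0 < right (Suc (Suc n))" "right (Suc (Suc n)) < 1"
      using right_pos right_less_1 by auto
    consider "2 \<le> a n" | "a n = 1" "a (Suc n) = 1" | "a n = 1" "a (Suc n) = 2"
      using admissibleD(1,2)[OF adm Suc.prems] admissibleD(1)[OF adm, of "Suc n"] Suc.prems by fastforce
    then show ?case
    proof cases
      case 1
      then have "right n \<le> 1 / 2"
        using right_pos[of "Suc n"] by (intro right_le) auto
      then show ?thesis using theta_bounds p by linarith
    next
      case 2
      have "1 / 2 \<le> right (Suc n)"
        using 2 pos by (intro right_ge) auto
      then have "right n \<le> 2 / 3"
        using 2 right_le[of "3 / 2" n] by simp
      then show ?thesis using theta_bounds p by linarith
    next
      case 3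
      let ?y = "right (Suc (Suc n))"
      have "right n = 1 / (1 + 1 / (2 + ?y))"
        using right_unfold[of n] right_unfold[of "Suc n"] 3 by simp
      then have eq: "right n - theta = (?y - theta) / ((3 + ?y) * (3 + theta))"
        using theta_step[of ?y] pos by simp
      show ?thesis
      proof (cases "?y \<le> theta")
        case True
        then have "right n - theta \<le> 0"
          unfolding eq using pos theta_bounds by (intro divide_nonpos_pos) auto
        then show ?thesis using p by linarith
      next
        case False
        then have "right n - theta \<le> (?y - theta) / (3 * 3)"
          unfolding eq using pos theta_bounds by (intro divide_left_mono mult_mono) auto
        then show ?thesis using Suc.IH[of "Suc (Suc n)"] Suc.prems by simp
      qed
    qed
  qed
  from this[OF assms(3)] have "\<And>k. right n - theta \<le> (1 / 9) ^ k" .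
  moreover have "(\<lambda>k. (1 / 9 :: real) ^ k) \<longlonglongrightarrow> 0"
    by (rule LIMSEQ_realpow_zero) auto
  ultimately have "right n - theta \<le> 0"
    by (intro LIMSEQ_le_const) auto
  then show ?thesis by simp
qed

text \<open>The backward expansion is finite, so it cannot run through \<open>1, 2, 1, 2, \<dots>\<close> forever; a
  digit \<open>3\<close> in the past is what makes the inequality strict.\<close>

lemma left_less_theta:
  assumes adm: "admissible a N" and "0 < N" "N \<le> m" "a m = 3" "m < n"
  shows "left n < theta"
  using \<open>m < n\<close>
proof (induction n rule: less_induct)
  case (less n)
  then obtain k where k: "n = Suc k" "m \<le> k" by (cases n) auto
  have k0: "0 < k" using k assms by simp
  consider "2 \<le> a k" | "a k = 1"
    using admissibleD(1)[OF adm, of k] k assms by force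
  then show ?case
  proof cases
    case 1
    then have "left n \<le> 1 / 2"
      unfolding k using left_nonneg[of k] k0 by (intro left_le) auto
    then show ?thesis using theta_bounds by simp
  next
    case 2
    then have "k \<noteq> m" using assms by auto
    then obtain j where j: "k = Suc j" "m \<le> j" using k by (cases k) auto
    have j0: "0 < j" using j assms by simp
    \<comment> \<open>Since \<open>31\<close> is forbidden, the \<open>3\<close> at \<open>m\<close>
      is not right before this \<open>1\<close>; so \<open>m < j\<close>, and the induction
      hypothesis covers \<open>left j\<close>.\<close>
    have "a j \<noteq> 3" using admissibleD(3)[OF adm, of j] j 2 assms by auto
    then have "m < j" using j assms by (cases "m = j") auto
    consider "a j = 1" | "a j = 2"
      using admissibleD(1)[OF adm, of j] j assms \<open>a j \<noteq> 3\<close> by force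
    then show ?thesis
    proof cases
      case 1
      then have "1 / 2 \<le> left k"
        unfolding j using left_le_1[of j] j0 by (intro left_ge) auto
      then have "left n \<le> 1 / (3 / 2)"
        unfolding k using 2 k0 by (intro left_le) auto
      then show ?thesis using theta_bounds by simp
    next
      case 22: 2
      have "left n = 1 / (1 + 1 / (2 + left j))"
        using left_Suc[OF k0] left_Suc[OF j0] 2 22 by (simp add: k j)
      then have "left n - theta = (left j - theta) / ((3 + left j) * (3 + theta))"
        using theta_step[OF left_nonneg[of j]] by simp
      also have "\<dots> < 0"
        using less.IH[of j] \<open>m < j\<close> j k theta_bounds left_nonneg[of j]
        by (intro divide_neg_pos) auto
      finally show ?thesis by simp
    qed
  qed
qed

text \<open>A central digit below 3 and the word \<open>333\<close> give clearly smaller sums. In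
  \<open>233\<close> and \<open>332\<close> the digit \<open>2\<close> continues with
  \<open>1\<close>, so that side is a \<open>short_tail\<close> and the other is bounded by
  \<open>long_tail theta\<close>. In both, strictness comes from the backward tail.\<close>

lemma eventually_lam_less:
  assumes "admissible a N"
  shows "\<forall>\<^sub>F n in sequentially. lam n < 3 + long_tail theta + short_tail theta"
proof -
  define K where "K = Suc N"
  have adm: "admissible a K" and K: "0 < K"
    using admissible_mono[OF assms] by (auto simp: K_def)
  note D = admissibleD[OF adm]
  have a_le: "a n \<le> 3" if "K \<le> n" for n using D(1)[OF that] by auto
  have r: "1 / 4 \<le> right n" "right n \<le> theta" if "K \<le> n" for n
    using right_bounds(1)[of n] right_le_theta[OF adm K that] a_le that K by auto
  have l: "1 / 4 \<le> left n" "left n \<le> 4 / 5" if "K + 2 \<le> n" for n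
    using left_bounds[of "n - 2"] a_le[of "n - 2"] a_le[of "n - 1"] that K
    by (auto simp: Suc_diff_le numeral_2_eq_2 Suc_diff_Suc)
  have small_digit: "lam n < 3 + long_tail theta + short_tail theta" if "K + 2 \<le> n" "a n \<le> 2" for n
    using that r[of "Suc n"] l[of n] theta_bounds long_tail_theta_gt short_tail_theta_gt
    by (simp add: lam_def)
  show ?thesis
  proof (cases "\<exists>m\<ge>K. a m = 3")
    case False
    then have "a n \<le> 2" if "K + 2 \<le> n" for n using D(1)[of n] that by auto
    then show ?thesis
      using small_digit unfolding eventually_sequentially by blast
  next
    case True
    then obtain m where m: "K \<le> m" "a m = 3" by auto
    have lt: "left n < theta" if "m < n" for n
      using left_less_theta[OF adm K m that] .
    \<comment> \<open>The offset keeps the four positions before \<open>n\<close> beyond the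
      \<open>3\<close> at \<open>m\<close>, where \<open>left\<close> is strictly below
      \<open>theta\<close>.\<close>
    have "lam n < 3 + long_tail theta + short_tail theta" if n: "m + 7 \<le> n" for n
    proof -
      define k where "k = n - 4"
      have n_eq: "n = Suc (Suc (Suc (Suc k)))" and k: "m + 3 \<le> k" "K + 3 \<le> k"
        using n m by (auto simp: k_def)
      have l': "1 / 4 \<le> left j" "left j < theta" if "k \<le> j" for j
        using l[of j] lt[of j] that k by auto
      have r': "1 / 4 \<le> right j" "right j \<le> theta" if "k \<le> j" for j
        using r[of j] that k by auto
      have ls: "left (Suc j) = 1 / (a j + left j)" if "k \<le> j" for j
        using left_Suc[of j] that k by simp
      define q where "q = Suc (Suc (Suc k))"
      have nq: "n = Suc q" and qk: "k \<le> q" by (auto simp: n_eq q_def)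
      have D': "a j = 1 \<or> a j = 2 \<or> a j = 3" 
        "a j = 1 \<Longrightarrow> a (Suc j) \<noteq> 3" "a j = 3 \<Longrightarrow> a (Suc j) \<noteq> 1"
        "a j = 2 \<Longrightarrow> a (Suc j) = 3 \<Longrightarrow> a (Suc (Suc j)) \<noteq> 2"
        "a (Suc j) = 2 \<Longrightarrow> a (Suc (Suc j)) = 3 \<Longrightarrow> a j = 1"
        "a j = 3 \<Longrightarrow> a (Suc j) = 2 \<Longrightarrow> a (Suc (Suc j)) = 1" if "k \<le> j" for j
        using D[of j] that k by auto
      have R: "right j = 1 / (a j + right (Suc j))" for j by (rule right_unfold)
      consider "a n \<le> 2" | "a n = 3" "a q = 3" "a (Suc n) = 3"
        | "a n = 3" "a q = 2" "a (Suc n) = 3" | "a n = 3" "a q = 3" "a (Suc n) = 2"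
        using D'(1,2,3,4)[of q] D'(1,3)[of n] D'(1)[of "Suc n"] qk
        by (auto simp: nq)
      then show ?thesis
      proof cases
        case 1
        then show ?thesis using small_digit[of n] n m by simp
      next
        case 2
        have "left n \<le> 1 / 3"
          unfolding nq using 2 qk k l'[of q] by (intro left_le) auto
        moreover have "right (Suc n) \<le> 1 / 3"
          using 2 right_pos[of "Suc (Suc n)"] by (intro right_le) auto
        ultimately show ?thesis
          using long_tail_theta_gt short_tail_theta_gt 2 by (simp add: lam_def)
      next
        case 3
        have 1: "a (Suc (Suc k)) = 1"
          using D'(5)[of "Suc (Suc k)"] 3 by (simp add: nq q_def)
        have "left n = 1 / (2 + 1 / (1 + left (Suc (Suc k))))"
          using ls[of q] ls[of "Suc (Suc k)"] 1 3 qk by (simp add: nq q_def)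
        then have "left n < short_tail theta"
          using short_tail_unfold[of "left (Suc (Suc k))"] short_tail_less[of "left (Suc (Suc k))" theta]
            l'[of "Suc (Suc k)"] by simp
        moreover have "right (Suc n) \<le> long_tail theta"
        proof (rule long_tail_bound(1)[of _ "right (Suc (Suc n))" "a (Suc (Suc n))" "right (Suc (Suc (Suc n)))" "a (Suc (Suc (Suc n)))" "right (Suc (Suc (Suc (Suc n))))" "a (Suc (Suc (Suc (Suc n))))" "right (Suc (Suc (Suc (Suc (Suc n)))))"])
          show "right (Suc n) = 1 / (3 + right (Suc (Suc n)))"
            using R[of "Suc n"] 3 by simp
          show "a (Suc (Suc n)) = 2 \<or> a (Suc (Suc n)) = 3"
            using D'(1)[of "Suc (Suc n)"] D'(3)[of "Suc n"] 3 nq qk by auto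
          show "a (Suc (Suc (Suc n))) = 2 \<or> a (Suc (Suc (Suc n))) = 3" if "a (Suc (Suc n)) = 3"
            using D'(1)[of "Suc (Suc (Suc n))"] D'(3)[of "Suc (Suc n)"] that nq qk by auto
          show "a (Suc (Suc (Suc (Suc n)))) = 1"
            if "a (Suc (Suc n)) = 3" "a (Suc (Suc (Suc n))) = 2"
            using D'(6)[of "Suc (Suc n)"] that nq qk by auto
          show "1 / 4 \<le> right (Suc (Suc (Suc n)))" "right (Suc (Suc (Suc n))) \<le> theta"
            "1 / 4 \<le> right (Suc (Suc (Suc (Suc n))))"
            "1 / 4 \<le> right (Suc (Suc (Suc (Suc (Suc n)))))"
            "right (Suc (Suc (Suc (Suc (Suc n))))) \<le> theta"
            using nq qk by (simp_all only: r' le_SucI)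
        qed (rule R)+
        ultimately show ?thesis using 3 by (simp add: lam_def)
      next
        case 4
        have 1: "a (Suc (Suc n)) = 1"
          using D'(6)[of n] 4 nq qk by simp
        have "right (Suc n) = 1 / (2 + 1 / (1 + right (Suc (Suc (Suc n)))))"
          using R[of "Suc n"] R[of "Suc (Suc n)"] 1 4 by simp
        then have "right (Suc n) \<le> short_tail theta"
          using short_tail_unfold[of "right (Suc (Suc (Suc n)))"]
            short_tail_less[of "right (Suc (Suc (Suc n)))" theta]
            r'[of "Suc (Suc (Suc n))"] nq qk by (cases "right (Suc (Suc (Suc n))) = theta") auto
        moreover have "left n < long_tail theta"
        proof (rule long_tail_bound(2)[of _ "left q" "a (Suc (Suc k))" "left (Suc (Suc k))" "a (Suc k)" "left (Suc k)" "a k" "left k"])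
          show "left n = 1 / (3 + left q)"
            using ls[of q] 4 qk by (simp add: nq)
          show "left q = 1 / (a (Suc (Suc k)) + left (Suc (Suc k)))"
            "left (Suc (Suc k)) = 1 / (a (Suc k) + left (Suc k))"
            "left (Suc k) = 1 / (a k + left k)"
            using ls by (auto simp: q_def)
          show "a (Suc (Suc k)) = 2 \<or> a (Suc (Suc k)) = 3"
            using D'(1,2)[of "Suc (Suc k)"] 4 by (auto simp: q_def)
          show "a (Suc k) = 2 \<or> a (Suc k) = 3" if "a (Suc (Suc k)) = 3"
            using D'(1,2)[of "Suc k"] that by auto
          show "a k = 1" if "a (Suc (Suc k)) = 3" "a (Suc k) = 2"
            using D'(5)[of k] that by auto
        qed (use l'[of k] l'[of "Suc k"] l'[of "Suc (Suc k)"] in auto)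
        ultimately show ?thesis using 4 by (simp add: lam_def)
      qed
    qed
    then show ?thesis
      unfolding eventually_sequentially by blast
  qed
qed

end

section \<open>The Lagrange constant\<close>

lemma irrational_continued_fraction:
  assumes "\<alpha> \<notin> \<rat>"
  obtains a x where "continued_fraction a x" "x 0 = \<alpha>"
proof -
  define x where "x = rec_nat \<alpha> (\<lambda>_ y. 1 / frac y)"
  have x: "x 0 = \<alpha>" "\<And>n. x (Suc n) = 1 / frac (x n)"
    by (simp_all add: x_def)
  have irr: "x n \<notin> \<rat>" for n
  proof (induction n)
    case (Suc n)
    show ?case
    proof
      assume "x (Suc n) \<in> \<rat>"
      then have "of_int \<lfloor>x n\<rfloor> + 1 / x (Suc n) \<in> \<rat>"
        by (intro Rats_add Rats_divide) auto
      then show False using Suc by (simp add: x frac_def)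
    qed
  qed (simp add: x assms)
  have frac_pos: "0 < frac (x n)" for n
    using irr[of n] Ints_subset_Rats by (auto simp: frac_gt_0_iff)
  have "continued_fraction (\<lambda>n. \<lfloor>x n\<rfloor>) x"
  proof
    fix n
    show "x n = of_int \<lfloor>x n\<rfloor> + 1 / x (Suc n)"
      by (simp add: x frac_def)
    show "1 < x (Suc n)"
      using frac_pos[of n] frac_lt_1[of "x n"] by (simp add: x)
  qed
  then show thesis using that x by blast
qed

lemma eventually_filtercomap_fst_sequentially:
  "eventually P (filtercomap fst sequentially) \<longleftrightarrow> (\<exists>N. \<forall>q\<ge>N. \<forall>p. P (q, p))"
proof
  assume "\<exists>N. \<forall>q\<ge>N. \<forall>p. P (q, p)"
  then obtain N where "\<forall>q\<ge>N. \<forall>p. P (q, p)" ..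
  then show "eventually P (filtercomap fst sequentially)"
    unfolding eventually_filtercomap
    by (intro exI[of _ "\<lambda>q. N \<le> q"]) (auto simp: eventually_ge_at_top)
qed (force simp: eventually_filtercomap eventually_sequentially)

text \<open>A lower limit of absolute values is nonnegative, and there inversion in the extended
  reals is injective.\<close>

lemma lagrange_constant_eq_iff:
  assumes "0 < c"
  shows "lagrange_constant \<alpha> = ereal c \<longleftrightarrow>
    Liminf (filtercomap fst sequentially)
      (\<lambda>(q::nat, p::int). ereal \<bar>real q * (real q * \<alpha> - of_int p)\<bar>) = ereal (1 / c)"
    (is "_ \<longleftrightarrow> ?L = _")
proof -
  have "0 \<le> ?L"
    by (rule Liminf_bounded) (auto simp: always_eventually)
  then show ?thesis
    using assms unfolding lagrange_constant_def
    by (cases ?L) (auto simp: inverse_eq_divide field_simps)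
qed

context continued_fraction
begin

text \<open>The hypothesis is applied to \<open>(den n, num n)\<close>, which is legitimate since
  the denominators grow without bound; Perron's formula does the rest.\<close>

lemma eventually_lam_less_of_liminf_greater:
  assumes "0 < c"
    and ev: "\<forall>\<^sub>F qp in filtercomap fst sequentially.
      1 / c < (case qp of (q::nat, p::int) \<Rightarrow> \<bar>real q * (real q * x 0 - of_int p)\<bar>)"
  obtains M where "\<And>n. M \<le> n \<Longrightarrow> lam n < c"
proof -
  obtain N where N: "\<And>(q::nat) (p::int). N \<le> q \<Longrightarrow> 1 / c < \<bar>real q * (real q * x 0 - of_int p)\<bar>"
    using ev by (auto simp: eventually_filtercomap_fst_sequentially)
  have "lam n < c" if n: "Suc N \<le> n" for n
  proof -
    have "int N \<le> den n"
      using den_ge[of "n - 1"] n by simp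
    then have "N \<le> nat (den n)" and dn: "real (nat (den n)) = den n"
      by auto
    from N[OF this(1), of "num n"] have "1 / c < \<bar>den n * err n\<bar>"
      unfolding dn by (simp add: err_def)
    also have "\<dots> = 1 / lam n"
      using n by (intro perron_formula) simp
    finally show ?thesis
      using lam_gt_1[of n] n assms(1) by (simp add: field_simps)
  qed
  then show thesis using that by blast
qed

end

lemma lam_less_of_lagrange_constant:
  assumes "continued_fraction a x" and eq: "lagrange_constant (x 0) = ereal c" and "0 < c" "c < d"
  obtains M where "\<And>n. M \<le> n \<Longrightarrow> continued_fraction.lam a x n < d"
proof -
  interpret continued_fraction a x by fact
  have "ereal (1 / d) < Liminf (filtercomap fst sequentially)
      (\<lambda>(q::nat, p::int). ereal \<bar>real q * (real q * x 0 - of_int p)\<bar>)"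
    using eq assms by (simp add: lagrange_constant_eq_iff frac_less2)
  then have "\<forall>\<^sub>F qp in filtercomap fst sequentially.
      ereal (1 / d) < (case qp of (q::nat, p::int) \<Rightarrow> ereal \<bar>real q * (real q * x 0 - of_int p)\<bar>)"
    by (rule less_LiminfD)
  then have "\<forall>\<^sub>F qp in filtercomap fst sequentially.
      1 / d < (case qp of (q::nat, p::int) \<Rightarrow> \<bar>real q * (real q * x 0 - of_int p)\<bar>)"
    by eventually_elim auto
  then show thesis
    using eventually_lam_less_of_liminf_greater[of d] assms(3,4) that by auto
qed

lemma not_attainable_of_lam_less:
  assumes "continued_fraction a x" and eq: "lagrange_constant (x 0) = ereal c" and "2 < c"
    and ev: "\<forall>\<^sub>F n in sequentially. continued_fraction.lam a x n < c"
  shows "\<not> attainable (x 0)"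
proof
  interpret continued_fraction a x by fact
  assume "attainable (x 0)"
  then have "infinite {(p::int, q::nat). q > 0 \<and>
      ereal \<bar>x 0 - of_int p / real q\<bar> \<le> 1 / (ereal c * ereal ((real q)\<^sup>2))}"
    by (simp add: attainable_def eq)
  moreover have "{(p::int, q::nat). q > 0 \<and>
      ereal \<bar>x 0 - of_int p / real q\<bar> \<le> 1 / (ereal c * ereal ((real q)\<^sup>2))}
    \<subseteq> {(p :: int, q :: nat). q > 0 \<and> \<bar>real q * (real q * x 0 - p)\<bar> \<le> 1 / c}"
    (is "?A \<subseteq> ?B")
  proof clarify
    fix p :: int and q :: nat
    assume q: "0 < q" and "ereal \<bar>x 0 - of_int p / real q\<bar> \<le> 1 / (ereal c * ereal ((real q)\<^sup>2))"
    then have le: "\<bar>x 0 - of_int p / real q\<bar> \<le> 1 / (c * (real q)\<^sup>2)"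
      using \<open>2 < c\<close> by (simp add: one_ereal_def)
    have "real q * (real q * x 0 - p) = (real q)\<^sup>2 * (x 0 - of_int p / real q)"
      using q by (simp add: power2_eq_square field_simps)
    then have "\<bar>real q * (real q * x 0 - p)\<bar> = (real q)\<^sup>2 * \<bar>x 0 - of_int p / real q\<bar>"
      by (simp add: abs_mult)
    also have "\<dots> \<le> (real q)\<^sup>2 * (1 / (c * (real q)\<^sup>2))"
      using le by (intro mult_left_mono) auto
    also have "\<dots> = 1 / c"
      using q by simp
    finally show "\<bar>real q * (real q * x 0 - p)\<bar> \<le> 1 / c" .
  qed
  ultimately show False
    using finite_good_approximations[OF \<open>2 < c\<close> ev] finite_subset[of ?A ?B] by argo
qed

text \<open>The lower limit is at least \<open>1 / c\<close> because only finitely many pairs with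
  \<open>0 < q\<close> have a product of at most \<open>1 / c\<close>. Were it larger, some
  \<open>r > 1 / c\<close> would give \<open>lam n < 1 / r < c\<close> eventually, against the limit
  along \<open>f\<close>.\<close>

lemma lagrange_constant_eqI:
  assumes "continued_fraction a x" and c: "2 < c"
    and ev: "\<forall>\<^sub>F n in sequentially. continued_fraction.lam a x n < c"
    and lim: "(\<lambda>k. continued_fraction.lam a x (f k)) \<longlonglongrightarrow> c" "filterlim f at_top sequentially"
  shows "lagrange_constant (x 0) = ereal c"
proof -
  interpret continued_fraction a x by fact
  let ?g = "\<lambda>(q::nat, p::int). ereal \<bar>real q * (real q * x 0 - of_int p)\<bar>"
  let ?L = "Liminf (filtercomap fst sequentially) ?g"
  define S where "S = {(p :: int, q :: nat). q > 0 \<and> \<bar>real q * (real q * x 0 - p)\<bar> \<le> 1 / c}"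
  have "finite S"
    unfolding S_def by (rule finite_good_approximations[OF c ev])
  then obtain B where "snd ` S \<subseteq> {..<B}"
    using finite_nat_iff_bounded[of "snd ` S"] by auto
  then have B: "q < B" if "(p, q) \<in> S" for p q
    using that by force
  have "ereal (1 / c) \<le> ?L"
  proof (rule Liminf_bounded, unfold eventually_filtercomap_fst_sequentially, intro exI allI impI)
    fix q :: nat and p :: int
    assume "Suc B \<le> q"
    then have "(p, q) \<notin> S" "0 < q" using B by force+
    then show "ereal (1 / c) \<le> ?g (q, p)"
      by (auto simp: S_def)
  qed
  moreover have "?L \<le> ereal (1 / c)"
  proof (rule ccontr)
    assume "\<not> ?L \<le> ereal (1 / c)"
    then obtain e where e: "ereal (1 / c) < e" "e < ?L"
      using dense[of "ereal (1 / c)" ?L] by (auto simp: not_le)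
    then obtain r where r: "e = ereal r"
      by (cases e) auto
    have "1 / c < r" using e r by simp
    moreover have "0 < 1 / c" using c by simp
    ultimately have "0 < r" by linarith
    then have rc: "1 / r < c"
      using \<open>1 / c < r\<close> c by (simp add: field_simps)
    have "\<forall>\<^sub>F qp in filtercomap fst sequentially. ereal r < ?g qp"
      using e r by (intro less_LiminfD) auto
    then have "\<forall>\<^sub>F qp in filtercomap fst sequentially.
        1 / (1 / r) < (case qp of (q::nat, p::int) \<Rightarrow> \<bar>real q * (real q * x 0 - of_int p)\<bar>)"
      by eventually_elim auto
    then obtain M where M: "\<And>n. M \<le> n \<Longrightarrow> lam n < 1 / r"
      using eventually_lam_less_of_liminf_greater[of "1 / r"] \<open>0 < r\<close> by auto
    have "\<forall>\<^sub>F k in sequentially. M \<le> f k"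
      using lim(2) by (simp add: filterlim_at_top)
    then have "\<forall>\<^sub>F k in sequentially. lam (f k) \<le> 1 / r"
      by eventually_elim (use M in \<open>auto intro: less_imp_le\<close>)
    then have "c \<le> 1 / r"
      using lim(1) by (intro tendsto_upperbound) auto
    then show False using rc by simp
  qed
  ultimately show ?thesis
    using c by (simp add: lagrange_constant_eq_iff)
qed

section \<open>A number with the prescribed Lagrange constant\<close>

lemma continued_fraction_exists:
  assumes "\<And>n. 1 \<le> a n"
  obtains x where "continued_fraction a x"
proof -
  define x where "x n = cfrac (smap a (fromN n))" for n
  have pos: "sset (smap a (fromN n)) \<subseteq> {1..}" for n
    using assms by (auto simp: stream.set_map)
  have x: "x n = a n + 1 / x (Suc n)" for n
    using cfrac_unfold[of "smap a (fromN n)"] pos[of "Suc n"] by (simp add: x_def)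
  have ge: "1 \<le> x n" for n
    unfolding x_def using pos by (rule cfrac_ge_1)
  have gt: "1 < x n" for n
  proof -
    have "0 < 1 / x (Suc n)" using ge[of "Suc n"] by simp
    moreover have "1 \<le> real_of_int (a n)" using assms[of n] by simp
    ultimately show ?thesis using x[of n] by linarith
  qed
  show thesis
    by (rule that, unfold_locales) (rule x gt)+
qed

context continued_fraction
begin

lemma right_near_theta:
  assumes "0 < n" "\<And>j. j < k \<Longrightarrow> a (n + 2 * j) = 1 \<and> a (Suc (n + 2 * j)) = 2"
  shows "\<bar>right n - theta\<bar> \<le> (1 / 9) ^ k"
  using assms
proof (induction k arbitrary: n)
  case 0
  then show ?case
    using right_pos[of n] right_less_1[of n] theta_bounds by (simp add: abs_le_iff)
next
  case (Suc k)
  have "\<bar>right (Suc (Suc n)) - theta\<bar> \<le> (1 / 9) ^ k"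
  proof (rule Suc.IH)
    show "a (Suc (Suc n) + 2 * j) = 1 \<and> a (Suc (Suc (Suc n) + 2 * j)) = 2" if "j < k" for j
      using Suc.prems(2)[of "Suc j"] that by simp
  qed simp
  moreover have "right n = 1 / (1 + 1 / (2 + right (Suc (Suc n))))"
    using right_unfold[of n] right_unfold[of "Suc n"] Suc.prems(2)[of 0] by simp
  ultimately show ?case
    using theta_step_abs[of "right (Suc (Suc n))"] right_pos[of "Suc (Suc n)"] by simp
qed

text \<open>Read backwards, the pairs \<open>2 1\<close> are periods \<open>1 2\<close>, each
  dividing the distance to \<open>theta\<close> by at least 9.\<close>

lemma left_near_theta:
  assumes "0 < n" "\<And>j. j < k \<Longrightarrow> a (n + 2 * j) = 2 \<and> a (Suc (n + 2 * j)) = 1"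
  shows "\<bar>left (n + 2 * k) - theta\<bar> \<le> (1 / 9) ^ k"
  using assms(2)
proof (induction k)
  case 0
  then show ?case
    using left_nonneg[of n] left_le_1[of n] theta_bounds by (simp add: abs_le_iff)
next
  case (Suc k)
  define m where "m = n + 2 * k"
  have m: "0 < m" "a m = 2" "a (Suc m) = 1"
    using assms(1) Suc.prems[of k] by (auto simp: m_def)
  have "\<bar>left m - theta\<bar> \<le> (1 / 9) ^ k"
    using Suc by (simp add: m_def)
  moreover have "left (Suc (Suc m)) = 1 / (1 + 1 / (2 + left m))"
    using m by (simp add: left_Suc)
  ultimately show ?case
    using theta_step_abs[of "left m"] left_nonneg[of m] by (simp add: m_def)
qed

end

text \<open>The digit sequence consists of the blocks \<open>1 2 3 3 3 2 1\<close> centred at the even positions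
  \<open>center k\<close>, separated by alternating \<open>1\<close>s and \<open>2\<close>s. All centres being even, the parity
  of the position makes both ends of each gap fit.\<close>

definition center :: "nat \<Rightarrow> nat" where
  "center k = 4 ^ (k + 2)"

definition digits :: "nat \<Rightarrow> int" where
  "digits n =
     (if \<exists>k. \<bar>int n - int (center k)\<bar> \<le> 1 then 3
      else if \<exists>k. \<bar>int n - int (center k)\<bar> = 2 then 2
      else if \<exists>k. \<bar>int n - int (center k)\<bar> = 3 then 1
      else if even n then 1 else 2)"

section \<open>Spacing of the blocks\<close>

lemma add_1_le_4_power: "k + 1 \<le> 4 ^ k"
  by (induction k) auto

lemma center_ge: "16 * k + 16 \<le> center k"
  using add_1_le_4_power[of k] by (simp add: center_def)

lemma center_gap:
  assumes "j < k"
  shows "center j + 12 * k + 12 \<le> center k"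
proof -
  obtain l where k: "k = Suc l" "j \<le> l" using assms by (cases k) auto
  have "l + 2 \<le> 4 * 4 ^ l" using add_1_le_4_power[of "Suc l"] by simp
  \<comment> \<open>Here \<open>48 * 4 ^ l\<close> is the distance between the consecutive centres
    \<open>l\<close> and \<open>k\<close>.\<close>
  from mult_le_mono2[OF this, of 12] have "12 * k + 12 \<le> 48 * 4 ^ l" by (simp add: k(1))
  moreover have "(4::nat) ^ j \<le> 4 ^ l" using k by (intro power_increasing) auto
  moreover have "center j = 16 * 4 ^ j" "center k = 64 * 4 ^ l" by (simp_all add: center_def k)
  ultimately show ?thesis by linarith
qed

text \<open>The radius \<open>2 * k + 8\<close> covers the block and \<open>k\<close> periods on
  either side. Another block, of radius 3, stays away because
  \<open>2 * k + 11 < 12 * k + 12\<close>.\<close>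

lemma center_unique:
  assumes "\<bar>int n - int (center k)\<bar> \<le> 2 * k + 8" "\<bar>int n - int (center j)\<bar> \<le> 3"
  shows "j = k"
proof (rule ccontr)
  assume "j \<noteq> k"
  then have "center j + 12 * k + 12 \<le> center k \<or> center k + 12 * k + 12 \<le> center j"
    using center_gap[of j k] center_gap[of k j] by (cases "j < k") auto
  then show False using assms by linarith
qed

lemma digits_near_center:
  assumes "\<bar>int n - int (center k)\<bar> \<le> 2 * k + 8"
  shows "digits n =
     (if \<bar>int n - int (center k)\<bar> \<le> 1 then 3
      else if \<bar>int n - int (center k)\<bar> = 2 then 2
      else if \<bar>int n - int (center k)\<bar> = 3 then 1
      else if even n then 1 else 2)"
proof -
  have "(\<exists>j. \<bar>int n - int (center j)\<bar> \<le> 1) \<longleftrightarrow> \<bar>int n - int (center k)\<bar> \<le> 1"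
    "(\<exists>j. \<bar>int n - int (center j)\<bar> = 2) \<longleftrightarrow> \<bar>int n - int (center k)\<bar> = 2"
    "(\<exists>j. \<bar>int n - int (center j)\<bar> = 3) \<longleftrightarrow> \<bar>int n - int (center k)\<bar> = 3"
    using center_unique[OF assms] by (force, force, force)
  then show ?thesis by (simp only: digits_def)
qed

lemma digits_eq_3: "digits n = 3 \<Longrightarrow> \<exists>k. \<bar>int n - int (center k)\<bar> \<le> 1"
  by (auto simp: digits_def split: if_splits)

lemma digits_cases: "digits n = 1 \<or> digits n = 2 \<or> digits n = 3"
  by (simp add: digits_def)

text \<open>Within distance 3 of a centre there are seven offsets to check; elsewhere none of the
  three digits in the window is \<open>3\<close>, so nothing can be violated.\<close>

lemma admissible_digits: "admissible digits N"
proof -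
  have "admissible_at digits n" for n
  proof (cases "\<exists>k. \<bar>int n - int (center k)\<bar> \<le> 3")
    case True
    then obtain k where k: "\<bar>int n - int (center k)\<bar> \<le> 3" ..
    define d where "d = int n - int (center k)"
    have digits: "digits m =
       (if \<bar>d + e\<bar> \<le> 1 then 3 else if \<bar>d + e\<bar> = 2 then 2 else if \<bar>d + e\<bar> = 3 then 1
        else if even m then 1 else 2)" if "int m = int n + e" "0 \<le> e" "e \<le> 2" for m e
    proof -
      have "int m - int (center k) = d + e" using that by (simp add: d_def)
      moreover have "\<bar>d + e\<bar> \<le> 2 * int k + 8" using k that by (simp add: d_def)
      ultimately show ?thesis using digits_near_center[of m k] by simp
    qed
    have "d \<in> {-3..3}" using k by (auto simp: d_def)
    also have "{-3..3} = {-3, -2, -1, 0, 1, 2, 3 :: int}" by auto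
    finally show ?thesis
      unfolding admissible_at_def
      using digits[of n 0] digits[of "Suc n" 1] digits[of "Suc (Suc n)" 2]
      by (elim insertE emptyE) auto
  next
    case False
    have "digits m \<noteq> 3" if m: "n \<le> m" "m \<le> n + 2" for m
    proof
      assume "digits m = 3"
      then obtain k where "\<bar>int m - int (center k)\<bar> \<le> 1"
        using digits_eq_3 by blast
      then have "\<bar>int n - int (center k)\<bar> \<le> 3" using m by linarith
      then show False using False by blast
    qed
    from this[of n] this[of "Suc n"] this[of "Suc (Suc n)"] show ?thesis
      using digits_cases[of n] by (simp add: admissible_at_def)
  qed
  then show ?thesis by (simp add: admissible_def)
qed

text \<open>At the first \<open>3\<close> of a block, \<open>lam\<close> is an exact continuous
  function of the two tails outside the block, and these converge to \<open>theta\<close> as the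
  gaps lengthen.\<close>

lemma lam_digits_tendsto:
  assumes "continued_fraction digits x"
  shows "(\<lambda>k. continued_fraction.lam digits x (center k - 1))
    \<longlonglongrightarrow> 3 + long_tail theta + short_tail theta"
proof -
  interpret continued_fraction digits x by fact
  have pow: "(\<lambda>k. (1 / 9 :: real) ^ k) \<longlonglongrightarrow> 0"
    by (rule LIMSEQ_realpow_zero) auto
  have even_center: "even (center k)" for k
    by (simp add: center_def)
  have "\<bar>right (center k + 4) - theta\<bar> \<le> (1 / 9) ^ k" for k
  proof (rule right_near_theta)
    fix j assume "j < k"
    then show "digits (center k + 4 + 2 * j) = 1 \<and> digits (Suc (center k + 4 + 2 * j)) = 2"
      using even_center[of k] by (simp add: digits_near_center[of _ k])
  qed simp
  then have "(\<lambda>k. right (center k + 4) - theta) \<longlonglongrightarrow> 0"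
    by (intro tendsto_0_le[OF pow, where K = 1]) auto
  then have R: "(\<lambda>k. right (center k + 4)) \<longlonglongrightarrow> theta"
    by (rule LIM_zero_cancel)
  have "\<bar>left (center k - 3) - theta\<bar> \<le> (1 / 9) ^ k" for k
  proof -
    \<comment> \<open>The \<open>k\<close> periods before the block start here, at an odd position
      and hence with digit \<open>2\<close>.\<close>
    define n where "n = center k - 3 - 2 * k"
    have n: "int n = int (center k) - 3 - 2 * int k" "0 < n" "center k - 3 = n + 2 * k"
      using center_ge[of k] by (auto simp: n_def)
    then have odd: "odd n"
      using even_center[of k] by presburger
    have "\<bar>left (n + 2 * k) - theta\<bar> \<le> (1 / 9) ^ k"
    proof (rule left_near_theta)
      fix j assume "j < k"
      then show "digits (n + 2 * j) = 2 \<and> digits (Suc (n + 2 * j)) = 1"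
        using odd n(1) by (simp add: digits_near_center[of _ k])
    qed (rule n)
    then show ?thesis by (simp only: n(3))
  qed
  then have "(\<lambda>k. left (center k - 3) - theta) \<longlonglongrightarrow> 0"
    by (intro tendsto_0_le[OF pow, where K = 1]) auto
  then have L: "(\<lambda>k. left (center k - 3)) \<longlonglongrightarrow> theta"
    by (rule LIM_zero_cancel)
  have "lam (center k - 1) = 3 + long_tail (right (center k + 4)) + short_tail (left (center k - 3))" for k
  proof -
    define m where "m = center k - 3"
    have m: "center k = m + 3" "0 < m"
      using center_ge[of k] by (auto simp: m_def)
    have d: "digits m = 1" "digits (m + 1) = 2" "digits (m + 2) = 3" "digits (m + 3) = 3"
      "digits (m + 4) = 3" "digits (m + 5) = 2" "digits (m + 6) = 1"
      using digits_near_center[of "m + i" k for i] by (simp_all add: m(1) digits_near_center[of _ k])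
    have "left (m + 2) = short_tail (left m)"
      using left_Suc[of "m + 1"] left_Suc[of m] d m left_nonneg[of m] short_tail_unfold[of "left m"]
      by (simp add: numeral_2_eq_2)
    moreover have "right (m + 3) = 1 / (3 + right (m + 4))" "right (m + 4) = 1 / (3 + right (m + 5))"
      "right (m + 5) = 1 / (2 + right (m + 6))" "right (m + 6) = 1 / (1 + right (m + 7))"
      using right_unfold[of "m + 3"] right_unfold[of "m + 4"] right_unfold[of "m + 5"]
        right_unfold[of "m + 6"] d by (simp_all add: eval_nat_numeral)
    then have "right (m + 3) = long_tail (right (m + 7))"
      using long_tail_unfold[of "right (m + 7)"] right_pos[of "m + 7"] by simp
    moreover have "lam (m + 2) = 3 + right (m + 3) + left (m + 2)"
      using d by (simp add: lam_def eval_nat_numeral)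
    ultimately show ?thesis
      by (simp add: m add.commute)
  qed
  moreover have "(\<lambda>k. 3 + long_tail (right (center k + 4)) + short_tail (left (center k - 3)))
    \<longlonglongrightarrow> 3 + long_tail theta + short_tail theta"
    unfolding long_tail_def short_tail_def
    using theta_bounds by (intro tendsto_intros R L) auto
  ultimately show ?thesis by simp
qed

lemma tail_sum_in_lagrange_spectrum: "3 + long_tail theta + short_tail theta \<in> lagrange_spectrum"
proof -
  have "1 \<le> digits n" for n
    using digits_cases[of n] by auto
  then obtain x where x: "continued_fraction digits x"
    by (rule continued_fraction_exists)
  have "filterlim (\<lambda>k. center k - 1) at_top sequentially"
  proof (rule filterlim_at_top_mono[OF filterlim_ident])
    show "\<forall>\<^sub>F k in sequentially. k \<le> center k - 1"
    proof (intro always_eventually allI)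
      show "k \<le> center k - 1" for k
        using center_ge[of k] by linarith
    qed
  qed
  moreover have "2 < 3 + long_tail theta + short_tail theta"
    using long_tail_theta_gt short_tail_theta_gt by simp
  ultimately have "lagrange_constant (x 0) = ereal (3 + long_tail theta + short_tail theta)"
    using lagrange_constant_eqI[OF x _ _ lam_digits_tendsto[OF x]]
      continued_fraction.eventually_lam_less[OF x admissible_digits[of 0]] by blast
  then show ?thesis
    using continued_fraction.irrational[OF x] by (auto simp: lagrange_spectrum_def)
qed

text \<open>Rationalising \<open>10 + 23 * sqrt 3\<close> and \<open>1 + 2 * sqrt 3\<close>, of
  norms \<open>- 1487\<close> and \<open>- 11\<close>, produces the denominator
  \<open>16357 = 1487 * 11\<close>.\<close>

lemma tail_sum_closed_form:
  "3 + long_tail theta + short_tail theta = (62976 - 1498 * sqrt 3) / 16357"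
proof -
  define s where "s = sqrt 3"
  have s: "s * s = 3" "0 < s" by (simp_all add: s_def)
  have "(3 + 7 * s) * 1487 = (453 - s) * (10 + 23 * s)" "s * 11 = (6 - s) * (1 + 2 * s)"
    using s(1) by (simp_all add: algebra_simps)
  then have "(3 + 7 * s) / (10 + 23 * s) = (453 - s) / 1487" "s / (1 + 2 * s) = (6 - s) / 11"
    using s(2) by (subst frac_eq_eq; simp)+
  moreover have "long_tail theta = (3 + 7 * s) / (10 + 23 * s)" "short_tail theta = s / (1 + 2 * s)"
    by (simp_all add: long_tail_def short_tail_def theta_def algebra_simps flip: s_def)
  ultimately have "long_tail theta = (453 - s) / 1487" "short_tail theta = (6 - s) / 11"
    by (simp_all only:)
  then show ?thesis by (simp add: s_def field_simps)
qed

theorem theorem1: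
  fixes lambda0 :: real
  assumes "lambda0 = cfrac ([3, 3, 3, 2, 1] @- cycle [1, 2]) + cfrac ([0, 2, 1] @- cycle [1, 2])"
  shows "lambda0 = (62976 - 1498 * sqrt 3) / 16357 \<and>
         lambda0 \<in> lagrange_spectrum \<and>
         (\<forall>\<alpha>. \<alpha> \<notin> \<rat> \<longrightarrow> lagrange_constant \<alpha> = ereal lambda0 \<longrightarrow> \<not> attainable \<alpha>)"
proof -
  have "cfrac ([3, 3, 3, 2, 1] @- cycle [1, 2]) = 3 + long_tail theta"
    using long_tail_unfold[of theta] theta_bounds sset_cycle_1_2
    by (simp add: cfrac_SCons cfrac_cycle_1_2 theta_def)
  moreover have "cfrac ([0, 2, 1] @- cycle [1, 2]) = short_tail theta"
    using short_tail_unfold[of theta] theta_bounds sset_cycle_1_2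
    by (simp add: cfrac_SCons cfrac_cycle_1_2 theta_def)
  ultimately have eq: "lambda0 = 3 + long_tail theta + short_tail theta"
    using assms by simp
  have bounds: "2 < lambda0" "lambda0 < 923 / 250"
    unfolding eq using long_tail_theta_gt short_tail_theta_gt tail_sum_less by auto
  have "\<not> attainable \<alpha>" if \<alpha>: "\<alpha> \<notin> \<rat>" "lagrange_constant \<alpha> = ereal lambda0" for \<alpha>
  proof -
    obtain a x where x: "continued_fraction a x" "x 0 = \<alpha>"
      using irrational_continued_fraction \<alpha>(1) by blast
    \<comment> \<open>The Lagrange constant controls \<open>lam\<close> only up to a positive
      margin, here the gap between \<open>lambda0\<close> and \<open>923 / 250\<close>.\<close>
    obtain M where "\<And>n. M \<le> n \<Longrightarrow> continued_fraction.lam a x n < 923 / 250"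
      using lam_less_of_lagrange_constant[OF x(1), of lambda0 "923 / 250"] x(2) \<alpha>(2) bounds by force
    then have "admissible a (M + 5)"
      by (rule continued_fraction.admissible_of_lam_less[OF x(1)])
    then show ?thesis
      using not_attainable_of_lam_less[OF x(1)] continued_fraction.eventually_lam_less[OF x(1)]
        x(2) \<alpha>(2) bounds(1) eq by auto
  qed
  then show ?thesis
    using tail_sum_in_lagrange_spectrum tail_sum_closed_form by (simp only: flip: eq) blast
qed

end
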